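(* Let $U(k,n)$ be the uniform matroid of rank $k$ on the ground set $[n]$. Then the combinatorial derived matroid $\delta U(k,n)$ is an adjoint of $U(k,n)$.
   Context: For a matroid $\mathcal M$ on ground set $E$ with $n=|E|$, $d=\mathrm{rank}(\mathcal M)$ and set of circuits $\mathcal C(\mathcal M)$, define $\mathcal S(\mathcal M)=\{\mathcal S\subseteq\mathcal C(\mathcal M): |\mathcal S|\le (n-d)-r_{\mathcal M^*}(\bigcap_{C\in\mathcal S}(E\setminus C))\}$ (empty intersection $=E$), where $\mathcal M^*$ is the dual matroid. For a collection $\mathfrak A$ of subsets of $\mathcal C(\mathcal M)$ let $\epsilon(\mathfrak A)=\mathfrak A\cup\{(\mathcal A_1\cup\mathcal A_2)\setminus\{C\}: \mathcal A_1,\mathcal A_2\in\mathfrak A,\ \mathcal A_1\cap\mathcal A_2\notin\mathfrak A,\ C\in\mathcal A_1\cap\mathcal A_2\}$ and $\uparrow\mathfrak A=\{\mathcal A\subseteq\mathcal C(\mathcal M):\exists\mathcal A'\in\mathfrak A,\ \mathcal A'\subseteq\mathcal A\}$. Set $\mathfrak A_0=\mathfrak A$, $\mathfrak A_{i+1}=\uparrow\epsilon(\mathfrak A_i)$, $D(\mathfrak A)=\bigcup_{i\ge0}\mathfrak A_i$; it is known that if $\emptyset\notin\mathfrak A$ then $D(\mathfrak A)$ is the family of dependent sets of a matroid on $\mathcal C(\mathcal M)$. The combinatorial derived matroid $\delta\mathcal M$ is the matroid on $\mathcal C(\mathcal M)$ with dependent sets $D(2^{\mathcal C(\mathcal M)}\setminus\mathcal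 S(\mathcal M))$. Adjoint: let $\mathcal L^*$ be the lattice of flats of $\mathcal M^*$ and $(\mathcal L^* )^{opp}$ its order dual (rank function $(n-d)-r_{\mathcal M^*}$), whose atoms are the hyperplanes $E\setminus C$ of $\mathcal M^*$, $C\in\mathcal C(\mathcal M)$. A matroid $\mathcal N$ on $\mathcal C(\mathcal M)$ with lattice of flats $\mathcal L(\mathcal N)$ is an adjoint of $\mathcal M$ if the map $E\setminus C\mapsto\mathrm{cl}_{\mathcal N}(\{C\})$ is a bijection from the atoms of $(\mathcal L^* )^{opp}$ onto the atoms of $\mathcal L(\mathcal N)$ and extends to a rank-preserving order embedding $f:(\mathcal L^* )^{opp}\to\mathcal L(\mathcal N)$ ($x\le y\iff f(x)\le f(y)$, ranks preserved). *)

theory Defs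
  imports "HOL-Algebra.Lattice"
begin

record 'a matroid =
  ground :: "'a set"
  indep :: "'a set set"

definition is_matroid :: "'a matroid \<Rightarrow> bool" where
  "is_matroid M \<longleftrightarrow>
     finite (ground M) \<and>
     indep M \<subseteq> Pow (ground M) \<and>
     {} \<in> indep M \<and>
     (\<forall>I J. I \<in> indep M \<and> J \<subseteq> I \<longrightarrow> J \<in> indep M) \<and>
     (\<forall>I J. I \<in> indep M \<and> J \<in> indep M \<and> card I < card J \<longrightarrow>
        (\<exists>x \<in> J - I. insert x I \<in> indep M))"

definition circuits :: "'a matroid \<Rightarrow> 'a set set" where
  "circuits M = {C. C \<subseteq> ground M \<and> C \<notin> indep M \<and> (\<forall>X. X \<subset> C \<longrightarrow> X \<in> indep M)}"

definition bases :: "'a matroid \<Rightarrow> 'a set set" where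
  "bases M = {B \<in> indep M. \<forall>I \<in> indep M. B \<subseteq> I \<longrightarrow> I = B}"

definition rank_in :: "'a matroid \<Rightarrow> 'a set \<Rightarrow> nat" where
  "rank_in M X = Max (card ` {I \<in> indep M. I \<subseteq> X})"

abbreviation matroid_rank :: "'a matroid \<Rightarrow> nat" where
  "matroid_rank M \<equiv> rank_in M (ground M)"

(* The bases of the dual are the complements of the bases of M. *)
definition dual :: "'a matroid \<Rightarrow> 'a matroid" where
  "dual M = \<lparr>ground = ground M,
             indep = {I. I \<subseteq> ground M \<and> (\<exists>B \<in> bases M. I \<inter> B = {})}\<rparr>"

definition cl :: "'a matroid \<Rightarrow> 'a set \<Rightarrow> 'a set" where
  "cl M X = {x \<in> ground M. rank_in M (insert x X) = rank_in M X}"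

definition flats :: "'a matroid \<Rightarrow> 'a set set" where
  "flats M = {F. F \<subseteq> ground M \<and> cl M F = F}"

definition flat_lattice :: "'a matroid \<Rightarrow> 'a set gorder" where
  "flat_lattice M = \<lparr>carrier = flats M, eq = (=), le = (\<subseteq>)\<rparr>"

definition atoms :: "'a gorder \<Rightarrow> 'a set" where
  "atoms L = {a \<in> carrier L. \<bottom>\<^bsub>L\<^esub> \<sqsubset>\<^bsub>L\<^esub> a \<and>
     (\<forall>x \<in> carrier L. \<bottom>\<^bsub>L\<^esub> \<sqsubset>\<^bsub>L\<^esub> x \<and> x \<sqsubseteq>\<^bsub>L\<^esub> a \<longrightarrow> x = a)}"

definition uniform :: "nat \<Rightarrow> nat \<Rightarrow> nat matroid" where
  "uniform k n = \<lparr>ground = {1..n}, indep = {I. I \<subseteq> {1..n} \<and> card I \<le> k}\<rparr>"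

(* The rank function of the order dual of the lattice of flats of the dual matroid; int-valued,
   so the subtractions are not truncated. *)
definition opp_rank :: "'a matroid \<Rightarrow> 'a set \<Rightarrow> int" where
  "opp_rank M X = (int (card (ground M)) - int (matroid_rank M)) - int (rank_in (dual M) X)"

(* Intersecting with the ground set gives the empty family the intersection
   ground M, where Isabelle's own value would be UNIV. *)
definition small_families :: "'a matroid \<Rightarrow> 'a set set set" where
  "small_families M = {S. S \<subseteq> circuits M \<and>
     int (card S) \<le> opp_rank M (ground M \<inter> (\<Inter>C \<in> S. ground M - C))}"

definition eps :: "'c set set \<Rightarrow> 'c set set" where
  "eps \<AA> = \<AA> \<union> {(A1 \<union> A2) - {C} | A1 A2 C.
     A1 \<in> \<AA> \<and> A2 \<in> \<AA> \<and> A1 \<inter> A2 \<notin> \<AA> \<and> C \<in> A1 \<inter> A2}"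

definition up :: "'c set \<Rightarrow> 'c set set \<Rightarrow> 'c set set" where
  "up U \<AA> = {A. A \<subseteq> U \<and> (\<exists>A' \<in> \<AA>. A' \<subseteq> A)}"

definition dep_closure :: "'c set \<Rightarrow> 'c set set \<Rightarrow> 'c set set" where
  "dep_closure U \<AA> = (\<Union>i. ((\<lambda>\<BB>. up U (eps \<BB>)) ^^ i) \<AA>)"

definition derived_matroid :: "'a matroid \<Rightarrow> 'a set matroid" where
  "derived_matroid M = \<lparr>ground = circuits M,
     indep = Pow (circuits M) - dep_closure (circuits M) (Pow (circuits M) - small_families M)\<rparr>"

abbreviation dual_flats_opp :: "'a matroid \<Rightarrow> 'a set gorder" where
  "dual_flats_opp M \<equiv> inv_gorder (flat_lattice (dual M))"

(* An atom H = ground M - C of dual_flats_opp M comes from the circuit C = ground M - H. *)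
definition is_adjoint :: "'a set matroid \<Rightarrow> 'a matroid \<Rightarrow> bool" where
  "is_adjoint N M \<longleftrightarrow>
     is_matroid N \<and> ground N = circuits M \<and>
     bij_betw (\<lambda>H. cl N {ground M - H}) (atoms (dual_flats_opp M)) (atoms (flat_lattice N)) \<and>
     (\<exists>f \<in> carrier (dual_flats_opp M) \<rightarrow> carrier (flat_lattice N).
        (\<forall>H \<in> atoms (dual_flats_opp M). f H = cl N {ground M - H}) \<and>
        order_emb (dual_flats_opp M) (flat_lattice N) f \<and>
        (\<forall>F \<in> carrier (dual_flats_opp M). int (rank_in N (f F)) = opp_rank M F))"

end

theory Submission
  imports Defs
begin

text \<open>
  A nonempty set \<open>S\<close> of circuits of \<open>U(k,n)\<close> lies outside \<open>\<S>\<close> iff \<open>|S| > f(S)\<close>, where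
  \<open>f(S) = |\<Union>S| - k\<close> is monotone and submodular on pairs of sets that meet. For every such \<open>f\<close>,
  submodularity shows that \<open>\<epsilon>\<close> adds nothing to the family \<open>\<AA> = {S. |S| > f(S)}\<close>, nor to
  \<open>\<up>\<AA>\<close>; so \<open>D(\<AA>) = \<up>\<AA>\<close>, and the derived matroid is the matroid induced by \<open>f\<close>
  in the sense of Edmonds. A flat \<open>F\<close> of the dual \<open>U(n-k,n)\<close> is then sent to the set of all circuits
  disjoint from \<open>F\<close>, whose rank is \<open>n - |F| - k\<close>, witnessed by the circuits through a fixed
  \<open>k\<close>-set.
\<close>

section \<open>The iterated closure for an intersecting submodular function\<close>

lemma up_up: "up U (up U \<AA>) = up U \<AA>"
proof
  show "up U (up U \<AA>) \<subseteq> up U \<AA>"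
  proof
    fix A assume "A \<in> up U (up U \<AA>)"
    then obtain A' A'' where "A \<subseteq> U" "A' \<subseteq> A" "A'' \<subseteq> A'" "A'' \<in> \<AA>"
      unfolding up_def by blast
    then show "A \<in> up U \<AA>"
      unfolding up_def using order_trans[of A'' A' A] by blast
  qed
  show "up U \<AA> \<subseteq> up U (up U \<AA>)"
    unfolding up_def by blast
qed

text \<open>The value \<open>f {}\<close> is left free: submodularity is asked only of sets that
  meet. For \<open>|\<Union>S| - k\<close> with k > 0, resetting the value at \<open>{}\<close> to 0
  would break the inequality for the families {C} and {D} with C and D disjoint circuits, where it
  would read k + 2 \<le> 2.\<close>

locale intersecting_submodular =
  fixes U :: "'c set" and f :: "'c set \<Rightarrow> int"
  assumes finite_U: "finite U"
    and mono: "\<And>A B. A \<noteq> {} \<Longrightarrow> A \<subseteq> B \<Longrightarrow> B \<subseteq> U \<Longrightarrow> f A \<le> f B"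
    and submod: "\<And>A B. A \<subseteq> U \<Longrightarrow> B \<subseteq> U \<Longrightarrow> A \<inter> B \<noteq> {} \<Longrightarrow>
      f (A \<union> B) + f (A \<inter> B) \<le> f A + f B"
begin

text \<open>Nonemptiness is demanded because the intended \<open>f\<close> has
  \<open>f {} = - k\<close>: for k > 0 the empty family, which is small, would otherwise be put
  among the dependent ones.\<close>

definition excess :: "'c set set" where
  "excess = {A. A \<subseteq> U \<and> A \<noteq> {} \<and> f A < int (card A)}"

definition independents :: "'c set set" where
  "independents = Pow U - up U excess"

lemma finite_sub: "A \<subseteq> U \<Longrightarrow> finite A"
  using finite_U finite_subset by blast

lemma independents_iff:
  "I \<in> independents \<longleftrightarrow> I \<subseteq> U \<and> (\<forall>A \<subseteq> I. A \<noteq> {} \<longrightarrow> int (card A) \<le> f A)"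
  unfolding independents_def up_def excess_def by (auto simp: not_less)

text \<open>The intersection contains C and is not in \<open>excess\<close>, so its size is at most
  its \<open>f\<close>-value. Adding this to \<open>f A \<le> |A| - 1\<close> and
  \<open>f B \<le> |B| - 1\<close>, submodularity leaves the union a surplus of at least 2, of which
  the removal of C costs only 1.\<close>

lemma excess_elim:
  assumes A: "A \<in> excess" and B: "B \<in> excess" and AB: "A \<inter> B \<notin> excess"
    and C: "C \<in> A \<inter> B"
  shows "(A \<union> B) - {C} \<in> excess"
proof -
  have sub: "A \<subseteq> U" "B \<subseteq> U" and fA: "f A < int (card A)" and fB: "f B < int (card B)"
    using A B by (auto simp: excess_def)
  have fin: "finite A" "finite B"
    using sub finite_sub by auto
  have i: "int (card (A \<inter> B)) \<le> f (A \<inter> B)"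
    using AB C sub by (auto simp: excess_def)
  have card: "card (A \<union> B) + card (A \<inter> B) = card A + card B"
    using fin card_Un_Int by metis
  have big: "f (A \<union> B) + 2 \<le> int (card (A \<union> B))"
    using submod[OF sub] C fA fB i card by force
  \<comment> \<open>If nothing were left, both sets would equal {C}, and so would their
    intersection, which would then be in \<open>excess\<close>.\<close>
  have ne: "(A \<union> B) - {C} \<noteq> {}"
  proof
    assume "(A \<union> B) - {C} = {}"
    then have "A \<inter> B = A"
      using C by auto
    with AB A show False by simp
  qed
  have "f ((A \<union> B) - {C}) \<le> f (A \<union> B)"
    using mono[OF ne] sub by auto
  moreover have "int (card ((A \<union> B) - {C})) = int (card (A \<union> B)) - 1"
    using C fin card_Suc_Diff1[of "A \<union> B" C] by auto
  ultimately show ?thesis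
    using ne sub big by (auto simp: excess_def)
qed

lemma eps_excess: "eps excess = excess"
  unfolding eps_def using excess_elim by blast

lemma excess_subset_up: "excess \<subseteq> up U excess"
  by (auto simp: up_def excess_def)

text \<open>Choose members B1, B2 of \<open>excess\<close> below A1, A2. If C misses one of them,
  that one survives the removal of C. Otherwise elimination applies to B1 and B2, since an excessive
  B1 \<inter> B2 would make A1 \<inter> A2 dependent.\<close>

lemma up_eps_up_excess: "up U (eps (up U excess)) = up U excess"
proof -
  have "(A1 \<union> A2) - {C} \<in> up U excess"
    if A1: "A1 \<in> up U excess" and A2: "A2 \<in> up U excess" and
      n: "A1 \<inter> A2 \<notin> up U excess" and C: "C \<in> A1 \<inter> A2" for A1 A2 C
  proof -
    obtain B1 where B1: "B1 \<in> excess" "B1 \<subseteq> A1" "A1 \<subseteq> U"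
      using A1 by (auto simp: up_def)
    obtain B2 where B2: "B2 \<in> excess" "B2 \<subseteq> A2" "A2 \<subseteq> U"
      using A2 by (auto simp: up_def)
    have "B1 \<inter> B2 \<notin> excess"
      using n B1 B2 by (auto simp: up_def)
    then have both: "(B1 \<union> B2) - {C} \<in> excess" if "C \<in> B1" "C \<in> B2"
      using excess_elim[OF B1(1) B2(1)] that by simp
    consider "C \<notin> B1" | "C \<notin> B2" | "C \<in> B1" "C \<in> B2"
      by blast
    then obtain B where "B \<in> excess" "B \<subseteq> (A1 \<union> A2) - {C}"
    proof cases
      case 1
      then show ?thesis
        using B1 that[of B1] by blast
    next
      case 2
      then show ?thesis
        using B2 that[of B2] by blast
    next
      case 3
      have "(B1 \<union> B2) - {C} \<subseteq> (A1 \<union> A2) - {C}"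
        using B1 B2 by blast
      then show ?thesis
        using both[OF 3] that by blast
    qed
    then show ?thesis
      using B1 B2 unfolding up_def by blast
  qed
  then have "eps (up U excess) \<subseteq> up U excess"
    unfolding eps_def by blast
  then have eq: "eps (up U excess) = up U excess"
    unfolding eps_def by blast
  show ?thesis
    unfolding eq up_up ..
qed

text \<open>The iteration is constant from stage 1 on: \<open>eps\<close> fixes
  \<open>excess\<close>, and the whole step fixes \<open>up U excess\<close>.\<close>

lemma dep_closure_excess: "dep_closure U excess = up U excess"
proof -
  define step where "step = (\<lambda>\<BB>. up U (eps \<BB>))"
  have iter: "(step ^^ i) excess = (if i = 0 then excess else up U excess)" for i
    by (induction i) (simp_all add: step_def eps_excess up_eps_up_excess)
  then have "(step ^^ i) excess \<subseteq> up U excess" for i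
    using excess_subset_up by simp
  moreover have "up U excess = (step ^^ 1) excess"
    unfolding iter by simp
  ultimately show ?thesis
    unfolding dep_closure_def step_def[symmetric] by blast
qed

section \<open>Tight sets and the exchange property\<close>

definition tight :: "'c set \<Rightarrow> bool" where
  "tight T \<longleftrightarrow> T \<noteq> {} \<and> int (card T) = f T"

text \<open>Uncrossing: the slacks \<open>f A - |A|\<close> of union and intersection are
  nonnegative inside \<open>I\<close>, and by submodularity they sum to at most the slacks of
  \<open>S\<close> and \<open>T\<close>, which are zero.\<close>

lemma tight_Un:
  assumes I: "I \<in> independents" and sub: "S \<subseteq> I" "T \<subseteq> I"
    and S: "tight S" and T: "tight T" and ST: "S \<inter> T \<noteq> {}"
  shows "tight (S \<union> T)"
proof -
  have IU: "I \<subseteq> U"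
    using I by (simp add: independents_iff)
  have le: "int (card A) \<le> f A" if "A \<subseteq> I" "A \<noteq> {}" for A
    using I that by (auto simp: independents_iff)
  have "finite S" "finite T"
    using sub IU finite_sub by auto
  then have "card (S \<union> T) + card (S \<inter> T) = card S + card T"
    using card_Un_Int by metis
  moreover have "f (S \<union> T) + f (S \<inter> T) \<le> f S + f T"
    using submod ST sub IU by auto
  moreover have "int (card (S \<union> T)) \<le> f (S \<union> T)" "int (card (S \<inter> T)) \<le> f (S \<inter> T)"
    using le[of "S \<union> T"] le[of "S \<inter> T"] sub ST by auto
  ultimately show ?thesis
    using S T by (auto simp: tight_def)
qed

text \<open>Elements that individually leave \<open>f T\<close> unchanged do so jointly. In the
  induction, submodularity is applied to \<open>T \<union> A\<close> and \<open>insert x T\<close>,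
  whose intersection contains the nonempty set \<open>T\<close>.\<close>

lemma f_Un_span:
  assumes T: "T \<noteq> {}" "T \<subseteq> U" and A: "A \<subseteq> U" "\<And>x. x \<in> A \<Longrightarrow> f (insert x T) = f T"
  shows "f (T \<union> A) = f T"
proof -
  have "finite A"
    using A finite_sub by auto
  then show ?thesis
    using A
  proof (induction A)
    case empty
    then show ?case by simp
  next
    case (insert x A)
    have IH: "f (T \<union> A) = f T"
      using insert by auto
    let ?I = "(T \<union> A) \<inter> insert x T"
    have "f ((T \<union> A) \<union> insert x T) + f ?I \<le> f (T \<union> A) + f (insert x T)"
      using submod[of "T \<union> A" "insert x T"] T insert.prems(1) by blast
    moreover have "f T \<le> f ?I"
      using mono[of T ?I] T insert.prems(1) by blast
    moreover have "f (insert x T) = f T"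
      using insert.prems(2) by simp
    moreover have "f T \<le> f (T \<union> insert x A)"
      using mono[of T "T \<union> insert x A"] T insert.prems(1) by blast
    moreover have "(T \<union> A) \<union> insert x T = T \<union> insert x A"
      by blast
    ultimately show ?case
      using IH by simp
  qed
qed

text \<open>A violating set S must contain x. With T = S - {x}, the chain
  \<open>|T| \<le> f T \<le> f S \<le> |S| - 1 = |T|\<close> collapses to equalities.\<close>

lemma dependent_insert:
  assumes I: "I \<in> independents" and x: "x \<in> U" "f {x} \<ge> 1" and n: "insert x I \<notin> independents"
  obtains T where "T \<subseteq> I" "tight T" "f (insert x T) = f T"
proof -
  have IU: "I \<subseteq> U" and le: "\<And>A. A \<subseteq> I \<Longrightarrow> A \<noteq> {} \<Longrightarrow> int (card A) \<le> f A"
    using I by (auto simp: independents_iff)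
  obtain S where S: "S \<subseteq> insert x I" "S \<noteq> {}" "f S < int (card S)"
    using n x IU by (auto simp: independents_iff not_le)
  have xS: "x \<in> S"
    using S le[of S] by auto
  define T where "T = S - {x}"
  have TI: "T \<subseteq> I"
    using S T_def by auto
  have ST: "S = insert x T" "x \<notin> T"
    using xS by (auto simp: T_def)
  have fin: "finite T"
    using TI IU finite_sub by auto
  \<comment> \<open>Otherwise S = {x} would be the violating set, against
    \<open>f {x} \<ge> 1\<close>.\<close>
  have T0: "T \<noteq> {}"
    using S x ST by auto
  have "f T \<le> f S"
    using mono[OF T0, of S] ST TI IU x by auto
  moreover have "card S = Suc (card T)"
    using ST fin by simp
  moreover have "int (card T) \<le> f T"
    using le TI T0 by auto
  ultimately have "int (card T) = f T" "f S = f T"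
    using S by auto
  then show thesis
    using that[of T] TI T0 ST by (simp add: tight_def)
qed

text \<open>If nothing in \<open>J\<close> augments \<open>I\<close>, every element of \<open>J\<close> outside \<open>I\<close> is spanned by a
  tight subset of \<open>I\<close>. The maximal tight subsets are pairwise disjoint, and each spans at most as
  many elements of \<open>J\<close> as it has itself, so \<open>J\<close> is no larger than \<open>I\<close>.\<close>

lemma augmentation:
  assumes I: "I \<in> independents" and J: "J \<in> independents" and less: "card I < card J"
  shows "\<exists>x \<in> J - I. insert x I \<in> independents"
proof (rule ccontr)
  assume "\<not> ?thesis"
  then have nI: "\<And>x. x \<in> J - I \<Longrightarrow> insert x I \<notin> independents"
    by blast
  have IU: "I \<subseteq> U" and JU: "J \<subseteq> U"
    and leJ: "\<And>A. A \<subseteq> J \<Longrightarrow> A \<noteq> {} \<Longrightarrow> int (card A) \<le> f A"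
    using I J by (auto simp: independents_iff)
  have finI: "finite I" and finJ: "finite J"
    using IU JU finite_sub by auto
  define \<T> where "\<T> = {T. T \<subseteq> I \<and> tight T \<and> (\<forall>S. S \<subseteq> I \<and> tight S \<and> T \<subseteq> S \<longrightarrow> S = T)}"
  define sp where "sp T = {x \<in> J. f (insert x T) = f T}" for T
  have TI: "\<Union>\<T> \<subseteq> I"
    by (auto simp: \<T>_def)
  have fin\<T>: "finite \<T>"
    by (rule finite_subset[of _ "Pow I"]) (auto simp: \<T>_def finI)
  have finT: "finite T" if "T \<in> \<T>" for T
    using that finI finite_subset by (auto simp: \<T>_def)
  have disj: "S \<inter> T = {}" if "S \<in> \<T>" "T \<in> \<T>" "S \<noteq> T" for S T
  proof (rule ccontr)
    assume "S \<inter> T \<noteq> {}"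
    then have "tight (S \<union> T)"
      using tight_Un[OF I] that by (auto simp: \<T>_def)
    moreover have "S \<union> T \<subseteq> I"
      using that by (auto simp: \<T>_def)
    ultimately have "S \<union> T = S" "S \<union> T = T"
      using that unfolding \<T>_def by blast+
    with that show False by simp
  qed
  have ext: "\<exists>S \<in> \<T>. T \<subseteq> S" if "T \<subseteq> I" "tight T" for T
  proof -
    have "finite {S. S \<subseteq> I \<and> tight S}"
      by (rule finite_subset[of _ "Pow I"]) (auto simp: finI)
    moreover have "T \<in> {S. S \<subseteq> I \<and> tight S}"
      using that by simp
    ultimately have "\<exists>S \<in> {S. S \<subseteq> I \<and> tight S}. T \<subseteq> S \<and>
        (\<forall>R \<in> {S. S \<subseteq> I \<and> tight S}. S \<subseteq> R \<longrightarrow> S = R)"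
      by (rule finite_has_maximal2)
    then obtain S where S: "S \<subseteq> I" "tight S" "T \<subseteq> S"
      "\<forall>R \<in> {S. S \<subseteq> I \<and> tight S}. S \<subseteq> R \<longrightarrow> S = R"
      by (elim bexE conjE CollectE) (rule that)
    have "S \<in> \<T>"
      using S unfolding \<T>_def by simp metis
    with S(3) show ?thesis ..
  qed
  have cover: "J \<subseteq> (I - \<Union>\<T>) \<union> (\<Union>T \<in> \<T>. sp T)"
  proof
    fix x assume x: "x \<in> J"
    show "x \<in> (I - \<Union>\<T>) \<union> (\<Union>T \<in> \<T>. sp T)"
    proof (cases "x \<in> I")
      case True
      then show ?thesis
        using x by (auto simp: sp_def) (metis insert_absorb)
    next
      case False
      have "1 \<le> f {x}"
        using leJ[of "{x}"] x by simp
      then obtain T where T: "T \<subseteq> I" "tight T" "f (insert x T) = f T"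
        using dependent_insert[OF I, of x] nI x False JU by blast
      then obtain S where S: "S \<in> \<T>" "T \<subseteq> S"
        using ext by blast
      have SU: "S \<subseteq> U" "S \<noteq> {}" and T0: "T \<noteq> {}"
        using S T IU by (auto simp: \<T>_def tight_def)
      have xU: "x \<in> U"
        using x JU by auto
      \<comment> \<open>Being spanned passes from T to the larger S: for x outside S, the sets S and
        \<open>insert x T\<close> meet exactly in T.\<close>
      have "f (insert x S) = f S"
      proof (cases "x \<in> S")
        case True
        then show ?thesis by (simp add: insert_absorb)
      next
        case False
        have "S \<union> insert x T = insert x S" "S \<inter> insert x T = T"
          using S False by auto
        then have "f (insert x S) + f T \<le> f S + f (insert x T)"
          using submod[of S "insert x T"] SU xU S T0 by auto
        moreover have "f S \<le> f (insert x S)"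
          using mono[of S "insert x S"] SU xU by auto
        ultimately show ?thesis
          using T by simp
      qed
      then show ?thesis
        using x S by (auto simp: sp_def)
    qed
  qed
  \<comment> \<open>Independence of \<open>J\<close> bounds \<open>|sp T|\<close> by
    \<open>f (sp T)\<close>, and adding \<open>sp T\<close> to T does not raise \<open>f\<close>
    above \<open>f T = |T|\<close>.\<close>
  have sp_le: "card (sp T) \<le> card T" if "T \<in> \<T>" for T
  proof (cases "sp T = {}")
    case False
    have T: "T \<subseteq> U" "T \<noteq> {}" "int (card T) = f T"
      using that IU by (auto simp: \<T>_def tight_def)
    have spU: "sp T \<subseteq> U"
      using JU by (auto simp: sp_def)
    have "int (card (sp T)) \<le> f (sp T)"
      by (rule leJ) (use False in \<open>auto simp: sp_def\<close>)
    also have "\<dots> \<le> f (T \<union> sp T)"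
      using mono[OF False, of "T \<union> sp T"] T spU by auto
    also have "\<dots> = f T"
      by (rule f_Un_span) (use T spU in \<open>simp_all add: sp_def\<close>)
    finally show ?thesis
      using T by simp
  qed simp
  have finsp: "finite (\<Union>T \<in> \<T>. sp T)"
    using fin\<T> finJ by (auto simp: sp_def)
  have "card J \<le> card ((I - \<Union>\<T>) \<union> (\<Union>T \<in> \<T>. sp T))"
    using cover finI finsp by (intro card_mono) auto
  also have "\<dots> \<le> card (I - \<Union>\<T>) + card (\<Union>T \<in> \<T>. sp T)"
    by (rule card_Un_le)
  also have "card (\<Union>T \<in> \<T>. sp T) \<le> (\<Sum>T \<in> \<T>. card (sp T))"
    using fin\<T> by (rule card_UN_le)
  also have "\<dots> \<le> (\<Sum>T \<in> \<T>. card T)"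
    using sp_le by (rule sum_mono)
  also have "\<dots> = card (\<Union>\<T>)"
    by (rule card_Union_disjoint[symmetric])
      (use disj finT in \<open>auto simp: pairwise_def disjnt_def\<close>)
  also have "card (I - \<Union>\<T>) + card (\<Union>\<T>) = card I"
  proof -
    have "finite (\<Union>\<T>)"
      using TI finI finite_subset by blast
    then show ?thesis
      using TI finI by (metis add.commute card_Diff_subset card_mono le_add_diff_inverse)
  qed
  finally show False
    using less by simp
qed

lemma is_matroid_independents: "is_matroid \<lparr>ground = U, indep = independents\<rparr>"
proof -
  have "{} \<in> independents"
    by (auto simp: independents_iff)
  moreover have "J \<in> independents" if "I \<in> independents" "J \<subseteq> I" for I J
    using that unfolding independents_iff by (meson order_trans)
  moreover have "independents \<subseteq> Pow U"
    by (auto simp: independents_def)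
  ultimately show ?thesis
    using finite_U augmentation unfolding is_matroid_def by simp blast
qed

end

section \<open>Rank, circuits, dual and flats of uniform matroids\<close>

lemma rank_in_eqI:
  assumes "I \<in> indep M" "I \<subseteq> X" "card I = r" and "\<And>J. J \<in> indep M \<Longrightarrow> J \<subseteq> X \<Longrightarrow> card J \<le> r"
  shows "rank_in M X = r"
  unfolding rank_in_def
proof (rule Max_eqI)
  have "card ` {I \<in> indep M. I \<subseteq> X} \<subseteq> {..r}"
    using assms(4) by auto
  then show "finite (card ` {I \<in> indep M. I \<subseteq> X})"
    using finite_subset by blast
qed (use assms in auto)

lemma uniform_simps [simp]:
  "ground (uniform k n) = {1..n}"
  "indep (uniform k n) = {I. I \<subseteq> {1..n} \<and> card I \<le> k}"
  by (simp_all add: uniform_def)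

lemma rank_in_uniform:
  assumes X: "X \<subseteq> {1..n}"
  shows "rank_in (uniform k n) X = min (card X) k"
proof -
  have fin: "finite X"
    using X finite_subset by blast
  have "min (card X) k \<le> card X"
    by simp
  then obtain I where "I \<subseteq> X" "card I = min (card X) k"
    by (rule obtain_subset_with_card_n)
  then show ?thesis
    using X fin by (intro rank_in_eqI[of I]) (auto intro: card_mono)
qed

lemma circuits_uniform: "circuits (uniform k n) = {C. C \<subseteq> {1..n} \<and> card C = Suc k}"
proof (intro equalityI subsetI)
  fix C assume C: "C \<in> circuits (uniform k n)"
  then have sub: "C \<subseteq> {1..n}" and gt: "k < card C"
    by (auto simp: circuits_def)
  from gt have "Suc k \<le> card C"
    by simp
  then obtain D where D: "D \<subseteq> C" "card D = Suc k"
    by (rule obtain_subset_with_card_n)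
  have "D = C"
  proof (rule ccontr)
    assume "D \<noteq> C"
    then have "D \<in> indep (uniform k n)"
      using C D unfolding circuits_def by blast
    with D show False by simp
  qed
  with D sub show "C \<in> {C. C \<subseteq> {1..n} \<and> card C = Suc k}" by simp
next
  fix C assume C: "C \<in> {C. C \<subseteq> {1..n} \<and> card C = Suc k}"
  then have "finite C"
    using finite_subset by blast
  then have "X \<subset> C \<Longrightarrow> card X \<le> k" for X
    using C psubset_card_mono[of C X] by auto
  with C show "C \<in> circuits (uniform k n)"
    by (auto simp: circuits_def)
qed

lemma bases_uniform:
  assumes "k \<le> n"
  shows "bases (uniform k n) = {B. B \<subseteq> {1..n} \<and> card B = k}"
proof (intro equalityI subsetI)
  fix B assume B: "B \<in> bases (uniform k n)"
  then have sub: "B \<subseteq> {1..n}" and le: "card B \<le> k"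
    by (auto simp: bases_def)
  have fin: "finite B"
    using sub finite_subset by blast
  have "card B = k"
  proof (rule ccontr)
    assume "card B \<noteq> k"
    then have less: "card B < k"
      using le by simp
    then have "B \<noteq> {1..n}"
      using assms by auto
    then obtain x where x: "x \<in> {1..n}" "x \<notin> B"
      using sub by blast
    then have "insert x B \<in> indep (uniform k n)"
      using sub less fin by simp
    then have "insert x B = B"
      using B unfolding bases_def by blast
    with x show False by blast
  qed
  with sub show "B \<in> {B. B \<subseteq> {1..n} \<and> card B = k}" by simp
next
  fix B assume B: "B \<in> {B. B \<subseteq> {1..n} \<and> card B = k}"
  have "I = B" if "I \<subseteq> {1..n}" "card I \<le> k" "B \<subseteq> I" for I
  proof -
    have "finite I"
      using that finite_subset by blast
    then show ?thesis
      using B that card_seteq[of I B] by auto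
  qed
  with B show "B \<in> bases (uniform k n)"
    by (auto simp: bases_def)
qed

lemma dual_uniform:
  assumes "k \<le> n"
  shows "dual (uniform k n) = uniform (n - k) n"
proof -
  have "(\<exists>B. B \<subseteq> {1..n} \<and> card B = k \<and> I \<inter> B = {}) \<longleftrightarrow> card I \<le> n - k" if I: "I \<subseteq> {1..n}" for I
  proof -
    have fin: "finite I"
      using I finite_subset by blast
    have c: "card ({1..n} - I) = n - card I"
      using I fin by (simp add: card_Diff_subset)
    have "card I \<le> n"
      using I card_mono[of "{1..n}" I] by simp
    then have iff: "card I \<le> n - k \<longleftrightarrow> k \<le> card ({1..n} - I)"
      unfolding c using assms by linarith
    show ?thesis
      unfolding iff
    proof
      assume "\<exists>B. B \<subseteq> {1..n} \<and> card B = k \<and> I \<inter> B = {}"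
      then obtain B where "B \<subseteq> {1..n} - I" "card B = k"
        by blast
      then show "k \<le> card ({1..n} - I)"
        using card_mono[of "{1..n} - I" B] by simp
    next
      assume "k \<le> card ({1..n} - I)"
      then obtain B where "B \<subseteq> {1..n} - I" "card B = k"
        by (rule obtain_subset_with_card_n)
      then show "\<exists>B. B \<subseteq> {1..n} \<and> card B = k \<and> I \<inter> B = {}"
        by blast
    qed
  qed
  then show ?thesis
    unfolding dual_def bases_uniform[OF assms] by (auto simp: uniform_def)
qed

lemma opp_rank_uniform:
  assumes "k \<le> n" "X \<subseteq> {1..n}"
  shows "opp_rank (uniform k n) X = int (n - k) - int (min (card X) (n - k))"
  using assms by (simp add: opp_rank_def dual_uniform rank_in_uniform)

text \<open>A set with at least k elements already has rank k and spans everything; below that size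
  every new element raises the rank.\<close>

lemma flats_uniform:
  "flats (uniform k n) = {F. F \<subseteq> {1..n} \<and> (card F < k \<or> F = {1..n})}"
proof -
  have "cl (uniform k n) F = F \<longleftrightarrow> card F < k \<or> F = {1..n}" if F: "F \<subseteq> {1..n}" for F
  proof -
    have fin: "finite F"
      using F finite_subset by blast
    have "cl (uniform k n) F = (if card F < k then F else {1..n})"
      using F fin by (auto simp: cl_def rank_in_uniform card_insert_if insert_absorb split: if_splits)
    then show ?thesis by auto
  qed
  then show ?thesis
    unfolding flats_def by auto
qed

section \<open>Atoms of lattices of flats\<close>

lemma weak_partial_order_flat_lattice: "weak_partial_order (flat_lattice M)"
  by unfold_locales (auto simp: flat_lattice_def)

text \<open>The bottom of a \<open>gorder\<close> is a choice among least elements. As the order is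
  inclusion, exhibiting one least flat determines that choice.\<close>

lemma atoms_flat_lattice:
  assumes B: "B \<in> flats M" "\<And>F. F \<in> flats M \<Longrightarrow> B \<subseteq> F"
  shows "atoms (flat_lattice M) =
    {a \<in> flats M. a \<noteq> B \<and> (\<forall>x \<in> flats M. x \<noteq> B \<and> x \<subseteq> a \<longrightarrow> x = a)}"
proof -
  have "\<bottom>\<^bsub>flat_lattice M\<^esub> = B"
    unfolding bottom_def
    by (rule some_equality) (use B in \<open>auto simp: least_def flat_lattice_def\<close>)
  then show ?thesis
    using B by (auto simp: atoms_def lless_def flat_lattice_def)
qed

lemma atoms_inv_flat_lattice:
  assumes T: "T \<in> flats M" "\<And>F. F \<in> flats M \<Longrightarrow> F \<subseteq> T"
  shows "atoms (inv_gorder (flat_lattice M)) =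
    {a \<in> flats M. a \<noteq> T \<and> (\<forall>x \<in> flats M. x \<noteq> T \<and> a \<subseteq> x \<longrightarrow> x = a)}"
proof -
  have "\<bottom>\<^bsub>inv_gorder (flat_lattice M)\<^esub> = T"
    unfolding bottom_def
    by (rule some_equality) (use T in \<open>auto simp: least_def flat_lattice_def\<close>)
  then show ?thesis
    using T by (auto simp: atoms_def lless_def flat_lattice_def)
qed

lemma atoms_dual_flats_uniform:
  assumes "k \<le> n"
  shows "atoms (dual_flats_opp (uniform k n)) = (\<lambda>C. {1..n} - C) ` circuits (uniform k n)"
    (is "?A = ?H")
proof -
  have flat: "F \<in> flats (dual (uniform k n)) \<longleftrightarrow> F \<subseteq> {1..n} \<and> (card F < n - k \<or> F = {1..n})" for F
    by (simp add: dual_uniform[OF assms] flats_uniform)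
  have A: "?A = {a \<in> flats (dual (uniform k n)). a \<noteq> {1..n} \<and>
      (\<forall>x \<in> flats (dual (uniform k n)). x \<noteq> {1..n} \<and> a \<subseteq> x \<longrightarrow> x = a)}"
    by (rule atoms_inv_flat_lattice) (auto simp: flat)
  have compl: "card ({1..n} - C) = n - Suc k" "Suc k \<le> n" "{1..n} - C \<noteq> {1..n}"
    if "C \<in> circuits (uniform k n)" for C
  proof -
    have C: "C \<subseteq> {1..n}" "card C = Suc k"
      using that by (auto simp: circuits_uniform)
    then have "finite C"
      using finite_subset by blast
    then show "card ({1..n} - C) = n - Suc k"
      using C by (simp add: card_Diff_subset)
    show "Suc k \<le> n"
      using C card_mono[of "{1..n}" C] by simp
    have "C \<noteq> {}"
      using C by auto
    then show "{1..n} - C \<noteq> {1..n}"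
      using C by blast
  qed
  show ?thesis
  proof (intro equalityI subsetI)
    fix a assume a: "a \<in> ?A"
    then have sub: "a \<subseteq> {1..n}" and less: "card a < n - k"
      unfolding A flat by auto
    have "finite a"
      using sub finite_subset by blast
    then have "Suc k \<le> card ({1..n} - a)"
      using sub less by (simp add: card_Diff_subset)
    \<comment> \<open>The complement of C is a proper flat containing a, so maximality of a forces
      equality.\<close>
    then obtain C where C: "C \<subseteq> {1..n} - a" "card C = Suc k"
      by (rule obtain_subset_with_card_n)
    then have circ: "C \<in> circuits (uniform k n)"
      by (auto simp: circuits_uniform)
    have "{1..n} - C \<in> flats (dual (uniform k n))"
      unfolding flat compl(1)[OF circ] using compl(2)[OF circ] by (simp add: diff_less_mono2)
    moreover have "a \<subseteq> {1..n} - C"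
      using C sub by blast
    moreover have "\<forall>x \<in> flats (dual (uniform k n)). x \<noteq> {1..n} \<and> a \<subseteq> x \<longrightarrow> x = a"
      using a unfolding A by simp
    ultimately have "{1..n} - C = a"
      using compl(3)[OF circ] by metis
    then show "a \<in> ?H"
      using circ by (metis imageI)
  next
    fix a assume "a \<in> ?H"
    then obtain C where C: "C \<in> circuits (uniform k n)" "a = {1..n} - C"
      by blast
    have "x = a" if x: "x \<in> flats (dual (uniform k n))" "x \<noteq> {1..n}" "a \<subseteq> x" for x
    proof -
      have "x \<subseteq> {1..n}" "card x < n - k"
        using x unfolding flat by simp_all
      then have "finite x" "card x \<le> card a"
        unfolding C(2) compl(1)[OF C(1)] by (auto intro: finite_subset)
      then show ?thesis
        using x(3) card_seteq[of x a] by simp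
    qed
    moreover have "a \<in> flats (dual (uniform k n))"
      unfolding flat C(2) compl(1)[OF C(1)] using compl(2)[OF C(1)] by (simp add: diff_less_mono2)
    moreover have "a \<noteq> {1..n}"
      unfolding C(2) by (rule compl(3)[OF C(1)])
    ultimately show "a \<in> ?A"
      unfolding A by simp
  qed
qed

section \<open>The derived matroid of U(k,n) as an induced matroid\<close>

lemma finite_circuits_uniform: "finite (circuits (uniform k n))"
  by (rule finite_subset[of _ "Pow {1..n}"]) (auto simp: circuits_uniform)

lemma Union_circuits_uniform: "S \<subseteq> circuits (uniform k n) \<Longrightarrow> \<Union>S \<subseteq> {1..n}"
  by (auto simp: circuits_uniform)

text \<open>Submodularity comes from inclusion-exclusion for the two unions; it is only an
  inequality because \<open>\<Union>(A \<inter> B)\<close> can be smaller than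
  \<open>\<Union>A \<inter> \<Union>B\<close>. The clause \<open>for k n\<close> makes both numbers
  arguments of the derived constants.\<close>

interpretation derived: intersecting_submodular
  "circuits (uniform k n)" "\<lambda>S. int (card (\<Union>S)) - int k" for k n
proof
  fix A B assume "A \<subseteq> B" "B \<subseteq> circuits (uniform k n)"
  then show "int (card (\<Union>A)) - int k \<le> int (card (\<Union>B)) - int k"
    using Union_circuits_uniform[of B k n] finite_subset[of "\<Union>B"] by (auto intro!: card_mono)
next
  fix A B assume sub: "A \<subseteq> circuits (uniform k n)" "B \<subseteq> circuits (uniform k n)"
  have fin: "finite (\<Union>A)" "finite (\<Union>B)"
    using sub[THEN Union_circuits_uniform] finite_subset by blast+
  have "card (\<Union>A) + card (\<Union>B) = card (\<Union>(A \<union> B)) + card (\<Union>A \<inter> \<Union>B)"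
    using card_Un_Int[OF fin] by (simp add: Union_Un_distrib)
  moreover have "card (\<Union>(A \<inter> B)) \<le> card (\<Union>A \<inter> \<Union>B)"
    using fin by (intro card_mono) auto
  ultimately show "int (card (\<Union>(A \<union> B))) - int k + (int (card (\<Union>(A \<inter> B))) - int k) \<le>
      int (card (\<Union>A)) - int k + (int (card (\<Union>B)) - int k)"
    by linarith
qed (rule finite_circuits_uniform)

lemma card_Union_circuits_gt:
  assumes "S \<subseteq> circuits (uniform k n)" "S \<noteq> {}"
  shows "k < card (\<Union>S)"
proof -
  obtain C where C: "C \<in> S"
    using assms by blast
  have "finite (\<Union>S)"
    using Union_circuits_uniform[OF assms(1)] finite_subset by blast
  then have "card C \<le> card (\<Union>S)"
    using C by (intro card_mono) auto
  moreover have "card C = Suc k"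
    using C assms(1) by (auto simp: circuits_uniform)
  ultimately show ?thesis by simp
qed

text \<open>The hyperplanes of S intersect in the complement of \<open>\<Union>S\<close>, of dual
  rank \<open>min (n - |\<Union>S|) (n - k)\<close>. For nonempty S the union has more than k
  elements, so the first term is the minimum and the bound becomes
  \<open>|\<Union>S| - k\<close>.\<close>

lemma not_small_eq_excess:
  assumes "k \<le> n"
  shows "Pow (circuits (uniform k n)) - small_families (uniform k n) = derived.excess k n"
proof -
  have "S \<notin> small_families (uniform k n) \<longleftrightarrow> S \<in> derived.excess k n"
    if S: "S \<subseteq> circuits (uniform k n)" for S
  proof -
    have sub: "\<Union>S \<subseteq> {1..n}"
      using Union_circuits_uniform[OF S] .
    then have fin: "finite (\<Union>S)"
      using finite_subset by blast
    have eq: "ground (uniform k n) \<inter> (\<Inter>C \<in> S. ground (uniform k n) - C) = {1..n} - \<Union>S"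
      by auto
    have c: "card ({1..n} - \<Union>S) = n - card (\<Union>S)"
      using sub fin by (simp add: card_Diff_subset)
    have le: "card (\<Union>S) \<le> n"
      using sub card_mono[of "{1..n}" "\<Union>S"] by simp
    have rank: "opp_rank (uniform k n) ({1..n} - \<Union>S) =
        int (n - k) - int (min (n - card (\<Union>S)) (n - k))"
      using opp_rank_uniform[OF assms, of "{1..n} - \<Union>S"] c by simp
    have small: "S \<in> small_families (uniform k n) \<longleftrightarrow>
        int (card S) \<le> int (n - k) - int (min (n - card (\<Union>S)) (n - k))"
      using S unfolding small_families_def mem_Collect_eq eq rank by simp
    show ?thesis
    proof (cases "S = {}")
      \<comment> \<open>Here the second term is the minimum: the bound is 0, so the empty family is
        small, in agreement with its exclusion from \<open>excess\<close>.\<close>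
      case True
      then show ?thesis
        unfolding small derived.excess_def by simp
    next
      case False
      have "k < card (\<Union>S)"
        using card_Union_circuits_gt[OF S False] .
      then have "int (n - k) - int (min (n - card (\<Union>S)) (n - k)) = int (card (\<Union>S)) - int k"
        using le assms by simp
      then show ?thesis
        unfolding small derived.excess_def using S False by auto
    qed
  qed
  moreover have "derived.excess k n \<subseteq> Pow (circuits (uniform k n))"
    by (auto simp: derived.excess_def)
  ultimately show ?thesis
    by blast
qed

lemma derived_matroid_uniform:
  assumes "k \<le> n"
  shows "derived_matroid (uniform k n) =
    \<lparr>ground = circuits (uniform k n), indep = derived.independents k n\<rparr>"
  unfolding derived_matroid_def not_small_eq_excess[OF assms] derived.dep_closure_excess
    derived.independents_def ..

section \<open>Flats of the derived matroid cut out by subsets of {1..n}\<close>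

abbreviation circuits_within :: "nat \<Rightarrow> nat set \<Rightarrow> nat set set" where
  "circuits_within k V \<equiv> {C. C \<subseteq> V \<and> card C = Suc k}"

text \<open>The circuits \<open>K \<union> {v}\<close> through a fixed \<open>k\<close>-set \<open>K\<close> each contribute a new element \<open>v\<close>.\<close>

lemma insert_star_independent:
  assumes K: "K \<subseteq> {1..n}" "card K = k" and W: "W \<subseteq> {1..n}" "K \<inter> W = {}"
    and C: "C \<in> circuits (uniform k n)" "\<not> C \<subseteq> K \<union> W"
  shows "insert C ((\<lambda>v. insert v K) ` W) \<in> derived.independents k n"
proof -
  have fin: "finite K" "finite W"
    using K W finite_subset by blast+
  have C': "C \<subseteq> {1..n}" "card C = Suc k"
    using C by (auto simp: circuits_uniform)
  then have finC: "finite C"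
    using finite_subset by blast
  have circ: "insert v K \<in> circuits (uniform k n)" if "v \<in> W" for v
  proof -
    have "v \<notin> K"
      using that W by blast
    then show ?thesis
      using that K W fin by (auto simp: circuits_uniform)
  qed
  have star: "int (card A) \<le> int (card (\<Union>A)) - int k"
    if A: "A \<subseteq> insert C ((\<lambda>v. insert v K) ` W)" "A \<noteq> {}" for A
  proof -
    have "A - {C} \<subseteq> (\<lambda>v. insert v K) ` W"
      using A by blast
    then obtain W' where W': "W' \<subseteq> W" "A - {C} = (\<lambda>v. insert v K) ` W'"
      by (rule subset_imageE)
    have finW': "finite W'"
      using W' fin finite_subset by blast
    have card_A: "card (A - {C}) \<le> card W'"
      unfolding W'(2) using finW' by (rule card_image_le)
    have KW': "card (K \<union> W') = k + card W'"
    proof -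
      have "K \<inter> W' = {}"
        using W(2) W'(1) by blast
      then show ?thesis
        using card_Un_disjoint[OF fin(1) finW'] K(2) by simp
    qed
    show ?thesis
    proof (cases "C \<in> A")
      case False
      then have "A = (\<lambda>v. insert v K) ` W'"
        using W' by simp
      moreover from this have "\<Union>A = K \<union> W'"
        using A by auto
      ultimately show ?thesis
        using KW' card_image_le[OF finW', of "\<lambda>v. insert v K"] by simp
    next
      case True
      then have A_eq: "A = insert C ((\<lambda>v. insert v K) ` W')"
        using insert_Diff[OF True] unfolding W'(2) by simp
      have "finite A"
        unfolding A_eq using finW' by simp
      then have card: "card A \<le> Suc (card W')"
        using card_A True card_Suc_Diff1[of A C] by simp
      show ?thesis
      \<comment> \<open>Without a star member in A, the set K need not be covered by
        \<open>\<Union>A\<close>; then A = {C} and the bound is \<open>|C| - k = 1\<close>.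
        Otherwise C contributes an element outside K \<union> W'.\<close>
      proof (cases "W' = {}")
        case True
        then show ?thesis
          using A_eq C' by simp
      next
        case False
        then have "\<Union>A = C \<union> (K \<union> W')"
          unfolding A_eq by auto
        moreover have "card (K \<union> W') < card (C \<union> (K \<union> W'))"
        proof (rule psubset_card_mono)
          show "finite (C \<union> (K \<union> W'))"
            using finC fin(1) finW' by simp
          show "K \<union> W' \<subset> C \<union> (K \<union> W')"
            using C(2) W'(1) by blast
        qed
        ultimately show ?thesis
          using KW' card by simp
      qed
    qed
  qed
  have "insert C ((\<lambda>v. insert v K) ` W) \<subseteq> circuits (uniform k n)"
    using C(1) circ by blast
  with star show ?thesis
    unfolding derived.independents_iff by blast
qed

text \<open>The star through a k-set K inside V supplies I, with one circuit for each element of V -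
  K. The last clause, that any circuit not inside V still extends I, is what later makes
  \<open>circuits_within k V\<close> closed.\<close>

lemma basis_of_circuits_within:
  assumes V: "V \<subseteq> {1..n}" "V = {} \<or> k < card V"
  obtains I where "I \<in> derived.independents k n" "I \<subseteq> circuits_within k V" "card I = card V - k"
    "\<And>C. C \<in> circuits (uniform k n) \<Longrightarrow> C \<notin> circuits_within k V \<Longrightarrow>
      insert C I \<in> derived.independents k n"
proof (cases "V = {}")
  case True
  show ?thesis
  proof (rule that[of "{}"])
    show "insert C {} \<in> derived.independents k n" if "C \<in> circuits (uniform k n)" for C
      unfolding derived.independents_iff using that by (auto simp: circuits_uniform subset_singleton_iff)
  qed (use True in \<open>auto simp: derived.independents_iff\<close>)
next
  case False
  then have gt: "k < card V"
    using V by simp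
  have finV: "finite V"
    using V finite_subset by blast
  obtain K where K: "K \<subseteq> V" "card K = k"
    using obtain_subset_with_card_n[OF less_imp_le[OF gt]] by blast
  have finK: "finite K"
    using K finV finite_subset by blast
  define W where "W = V - K"
  define I where "I = (\<lambda>v. insert v K) ` W"
  have within: "I \<subseteq> circuits_within k V"
    using K finK by (auto simp: I_def W_def)
  have inj: "inj_on (\<lambda>v. insert v K) W"
    by (auto simp: inj_on_def W_def)
  have card: "card I = card V - k"
    unfolding I_def card_image[OF inj] using K finK by (simp add: W_def card_Diff_subset)
  have ins: "insert C I \<in> derived.independents k n"
    if "C \<in> circuits (uniform k n)" "C \<notin> circuits_within k V" for C
  proof -
    have "\<not> C \<subseteq> K \<union> W"
      using that K by (auto simp: circuits_uniform W_def)
    then show ?thesis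
      unfolding I_def using K V that(1) by (intro insert_star_independent) (auto simp: W_def)
  qed
  show ?thesis
  proof (rule that)
    show "I \<in> derived.independents k n"
    proof -
      \<comment> \<open>One member of the star plays the role of the extra circuit C over the star
        on the remaining elements, since v lies outside K \<union> W0.\<close>
      obtain v where v: "v \<in> W"
        using gt K card finV by (metis I_def card.empty image_empty ex_in_conv zero_less_diff less_irrefl)
      define W0 where "W0 = W - {v}"
      have "insert (insert v K) ((\<lambda>v. insert v K) ` W0) \<in> derived.independents k n"
      proof (rule insert_star_independent)
        show "insert v K \<in> circuits (uniform k n)"
          using v K finK V(1) by (auto simp: circuits_uniform W_def)
        show "\<not> insert v K \<subseteq> K \<union> W0"
          using v by (auto simp: W0_def W_def)
      qed (use K V in \<open>auto simp: W0_def W_def\<close>)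
      moreover have "insert (insert v K) ((\<lambda>v. insert v K) ` W0) = I"
        using v by (auto simp: I_def W0_def)
      ultimately show ?thesis by simp
    qed
  qed (fact within card ins)+
qed

text \<open>An independent nonempty J inside V satisfies
  \<open>|J| \<le> |\<Union>J| - k \<le> |V| - k\<close>, and the star attains this. For V = {} the
  truncated difference is the correct rank 0.\<close>

lemma rank_in_derived:
  assumes "k \<le> n" and V: "V \<subseteq> {1..n}" "V = {} \<or> k < card V"
  shows "rank_in (derived_matroid (uniform k n)) (circuits_within k V) = card V - k"
proof -
  obtain I where I: "I \<in> derived.independents k n" "I \<subseteq> circuits_within k V" "card I = card V - k"
    by (rule basis_of_circuits_within[OF V])
  have finV: "finite V"
    using V finite_subset by blast
  have "card J \<le> card V - k" if J: "J \<in> derived.independents k n" "J \<subseteq> circuits_within k V" for J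
  proof (cases "J = {}")
    case False
    have "int (card J) \<le> int (card (\<Union>J)) - int k"
      using J False by (simp add: derived.independents_iff)
    moreover have "card (\<Union>J) \<le> card V"
      using J finV by (intro card_mono) auto
    ultimately show ?thesis by linarith
  qed simp
  then show ?thesis
    using I by (intro rank_in_eqI[of I]) (simp_all add: derived_matroid_uniform[OF assms(1)])
qed

lemma card_le_rank_in:
  assumes "finite (indep M)" "I \<in> indep M" "I \<subseteq> X"
  shows "card I \<le> rank_in M X"
  unfolding rank_in_def using assms by (intro Max_ge) auto

text \<open>A circuit outside V extends the basis I to a larger independent set, so adding it raises
  the rank.\<close>

lemma circuits_within_flat:
  assumes "k \<le> n" and V: "V \<subseteq> {1..n}" "V = {} \<or> k < card V"
  shows "cl (derived_matroid (uniform k n)) (circuits_within k V) = circuits_within k V"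
proof -
  let ?N = "derived_matroid (uniform k n)"
  note N = derived_matroid_uniform[OF assms(1)]
  obtain I where I: "I \<in> derived.independents k n" "I \<subseteq> circuits_within k V" "card I = card V - k"
    and ins: "\<And>C. C \<in> circuits (uniform k n) \<Longrightarrow> C \<notin> circuits_within k V \<Longrightarrow>
      insert C I \<in> derived.independents k n"
    by (rule basis_of_circuits_within[OF V]) blast
  have fin: "finite (indep ?N)"
    by (rule finite_subset[of _ "Pow (circuits (uniform k n))"])
      (auto simp: N derived.independents_iff finite_circuits_uniform)
  have finI: "finite I"
    using I(1) derived.finite_sub by (auto simp: derived.independents_iff)
  have "rank_in ?N (insert C (circuits_within k V)) \<noteq> rank_in ?N (circuits_within k V)"
    if C: "C \<in> circuits (uniform k n)" "C \<notin> circuits_within k V" for C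
  proof -
    have "C \<notin> I"
      using C(2) I(2) by blast
    then have "card (insert C I) = Suc (card V - k)"
      using I finI by simp
    moreover have "card (insert C I) \<le> rank_in ?N (insert C (circuits_within k V))"
      using fin ins[OF C] I(2) by (intro card_le_rank_in) (auto simp: N)
    ultimately show ?thesis
      using rank_in_derived[OF assms] by simp
  qed
  moreover have "circuits_within k V \<subseteq> circuits (uniform k n)"
    using V by (auto simp: circuits_uniform)
  ultimately show ?thesis
    unfolding cl_def by (auto simp: N insert_absorb)
qed

lemma circuits_within_circuit:
  assumes "C \<in> circuits (uniform k n)"
  shows "circuits_within k C = {C}"
proof -
  have "C \<subseteq> {1..n}" "card C = Suc k"
    using assms by (auto simp: circuits_uniform)
  moreover from this have "finite C"
    using finite_subset by blast
  ultimately show ?thesis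
    using card_subset_eq[of C] by auto
qed

text \<open>This is the case V = C. It says that no two distinct circuits are parallel in the
  derived matroid, so that its atoms will be the singletons.\<close>

lemma cl_derived_singleton:
  assumes "k \<le> n" "C \<in> circuits (uniform k n)"
  shows "cl (derived_matroid (uniform k n)) {C} = {C}"
  using circuits_within_flat[OF assms(1), of C] assms(2)
  unfolding circuits_within_circuit[OF assms(2)] by (auto simp: circuits_uniform)

lemma atoms_derived:
  assumes "k \<le> n"
  shows "atoms (flat_lattice (derived_matroid (uniform k n))) = (\<lambda>C. {C}) ` circuits (uniform k n)"
proof -
  let ?N = "derived_matroid (uniform k n)"
  have none: "circuits_within k {} = {}"
    by auto
  then have empty: "{} \<in> flats ?N"
    using circuits_within_flat[OF assms, of "{}"] unfolding flats_def none by simp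
  have single: "{C} \<in> flats ?N" if "C \<in> circuits (uniform k n)" for C
    using cl_derived_singleton[OF assms that] that
    by (simp add: flats_def derived_matroid_uniform[OF assms])
  have sub: "F \<subseteq> circuits (uniform k n)" if "F \<in> flats ?N" for F
    using that by (simp add: flats_def derived_matroid_uniform[OF assms])
  have A: "atoms (flat_lattice ?N) =
      {a \<in> flats ?N. a \<noteq> {} \<and> (\<forall>x \<in> flats ?N. x \<noteq> {} \<and> x \<subseteq> a \<longrightarrow> x = a)}"
    using empty by (rule atoms_flat_lattice) simp
  show ?thesis
  proof (intro equalityI subsetI)
    fix a assume a: "a \<in> atoms (flat_lattice ?N)"
    then obtain C where C: "C \<in> a"
      unfolding A by blast
    then have circ: "C \<in> circuits (uniform k n)"
      using a sub unfolding A by blast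
    have "{C} = a"
      using a C single[OF circ] unfolding A by blast
    then show "a \<in> (\<lambda>C. {C}) ` circuits (uniform k n)"
      using circ by blast
  next
    fix a assume "a \<in> (\<lambda>C. {C}) ` circuits (uniform k n)"
    then show "a \<in> atoms (flat_lattice ?N)"
      unfolding A using single by (auto simp: subset_singleton_iff)
  qed
qed

text \<open>V can be recovered from the circuits it contains: when |V| > k, each v in V extends some
  k-subset of V - {v} to a circuit inside V. This yields the order embedding.\<close>

lemma circuits_within_mono_iff:
  assumes "V = {} \<or> k < card V"
  shows "circuits_within k V \<subseteq> circuits_within k W \<longleftrightarrow> V \<subseteq> W"
proof
  assume sub: "circuits_within k V \<subseteq> circuits_within k W"
  show "V \<subseteq> W"
  proof
    fix v assume v: "v \<in> V"
    then have "k < card V"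
      using assms by blast
    then have "finite V" "k \<le> card (V - {v})"
      using v card_ge_0_finite[of V] by auto
    then obtain K where K: "K \<subseteq> V - {v}" "card K = k" "finite K"
      using obtain_subset_with_card_n[of k "V - {v}"] by metis
    have "v \<notin> K"
      using K by blast
    then have "insert v K \<in> circuits_within k V"
      using K v by auto
    then show "v \<in> W"
      using sub by blast
  qed
qed auto

section \<open>The adjoint map\<close>

theorem theorem6p5:
  fixes k n :: nat
  assumes "k \<le> n"
  shows "is_adjoint (derived_matroid (uniform k n)) (uniform k n)"
proof -
  let ?M = "uniform k n" and ?N = "derived_matroid (uniform k n)"
  define f where "f F = circuits_within k ({1..n} - F)" for F
  have carrier_dual: "carrier (dual_flats_opp ?M) =
      {F. F \<subseteq> {1..n} \<and> (card F < n - k \<or> F = {1..n})}"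
    by (simp add: flat_lattice_def dual_uniform[OF assms] flats_uniform)
  \<comment> \<open>Complements of dual flats are exactly of the shape that the results on
    \<open>circuits_within\<close> require; the empty complement belongs to the top flat.\<close>
  have compl: "{1..n} - F = {} \<or> k < card ({1..n} - F)" "card ({1..n} - F) = n - card F"
    if "F \<in> carrier (dual_flats_opp ?M)" for F
  proof -
    have F: "F \<subseteq> {1..n}" "card F < n - k \<or> F = {1..n}"
      using that unfolding carrier_dual by auto
    then have "finite F"
      using finite_subset by blast
    then show "card ({1..n} - F) = n - card F"
      using F by (simp add: card_Diff_subset)
    then show "{1..n} - F = {} \<or> k < card ({1..n} - F)"
      using F by auto
  qed
  have flat: "f F \<in> carrier (flat_lattice ?N)" if "F \<in> carrier (dual_flats_opp ?M)" for F
    using circuits_within_flat[OF assms _ compl(1)[OF that]]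
    by (auto simp: f_def flat_lattice_def flats_def derived_matroid_uniform[OF assms] circuits_uniform)
  have atom: "cl ?N {{1..n} - ({1..n} - C)} = {C}" "f ({1..n} - C) = {C}"
    if "C \<in> circuits ?M" for C
  proof -
    have "{1..n} - ({1..n} - C) = C"
      using that by (auto simp: circuits_uniform)
    then show "cl ?N {{1..n} - ({1..n} - C)} = {C}" "f ({1..n} - C) = {C}"
      using cl_derived_singleton[OF assms that] circuits_within_circuit[OF that]
      by (simp_all add: f_def)
  qed
  have "is_matroid ?N" "ground ?N = circuits ?M"
    using derived.is_matroid_independents by (simp_all add: derived_matroid_uniform[OF assms])
  moreover have "bij_betw (\<lambda>H. cl ?N {ground ?M - H})
      (atoms (dual_flats_opp ?M)) (atoms (flat_lattice ?N))"
    unfolding atoms_dual_flats_uniform[OF assms] atoms_derived[OF assms] bij_betw_def inj_on_def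
    by (auto simp: atom[simplified] image_image cong: image_cong)
  moreover have "f \<in> carrier (dual_flats_opp ?M) \<rightarrow> carrier (flat_lattice ?N)"
    using flat by blast
  moreover have "\<forall>H \<in> atoms (dual_flats_opp ?M). f H = cl ?N {ground ?M - H}"
    unfolding atoms_dual_flats_uniform[OF assms] uniform_simps using atom by auto
  moreover have "order_emb (dual_flats_opp ?M) (flat_lattice ?N) f"
    unfolding order_emb_def
  proof (intro conjI ballI)
    fix F G assume F: "F \<in> carrier (dual_flats_opp ?M)" and G: "G \<in> carrier (dual_flats_opp ?M)"
    have "F \<subseteq> {1..n}" "G \<subseteq> {1..n}"
      using F G unfolding carrier_dual by auto
    then have "{1..n} - F \<subseteq> {1..n} - G \<longleftrightarrow> G \<subseteq> F"
      by blast
    then show "f F \<sqsubseteq>\<^bsub>flat_lattice ?N\<^esub> f G \<longleftrightarrow> F \<sqsubseteq>\<^bsub>dual_flats_opp ?M\<^esub> G"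
      using circuits_within_mono_iff[OF compl(1)[OF F], of "{1..n} - G"]
      by (simp add: f_def flat_lattice_def)
  qed (intro weak_partial_order_flat_lattice
      weak_partial_order.dual_weak_order[OF weak_partial_order_flat_lattice])+
  moreover have "\<forall>F \<in> carrier (dual_flats_opp ?M). int (rank_in ?N (f F)) = opp_rank ?M F"
  proof
    fix F assume F: "F \<in> carrier (dual_flats_opp ?M)"
    then have sub: "F \<subseteq> {1..n}"
      unfolding carrier_dual by simp
    then have "card F \<le> n"
      using card_mono[of "{1..n}" F] by simp
    \<comment> \<open>For F = {1..n} the truncated difference is 0, as is \<open>opp_rank\<close>;
      for every other flat |F| < n - k, so nothing is truncated and the minimum in
      \<open>opp_rank\<close> is |F|.\<close>
    moreover have "rank_in ?N (f F) = n - card F - k"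
      unfolding f_def using rank_in_derived[OF assms _ compl(1)[OF F]] compl(2)[OF F] by simp
    ultimately show "int (rank_in ?N (f F)) = opp_rank ?M F"
      unfolding opp_rank_uniform[OF assms sub] using assms by (simp add: min_def)
  qed
  ultimately show ?thesis
    unfolding is_adjoint_def by blast
qed

end
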